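(* Let $W\ge 1$ be an integer and $0<\varepsilon<1$ be such that $W\varepsilon^{-1}=2^L$ for an integer $L$. Consider a window consisting of the last $W$ items of a stream over a universe of IDs, let $D$ be the number of distinct IDs in the window, and let $h$ be a random fingerprint function mapping IDs to $\{0,1,\dots,2^L-1\}$ such that the fingerprints of distinct IDs are independent and uniformly distributed. Let $Z=|\{h(y): y \text{ appears in the window}\}|$ and define $$\hat D=\frac{\ln\left(1-\frac{Z}{2^L}\right)}{\ln\left(1-\frac{1}{2^L}\right)}.$$ Then $$-D\cdot\varepsilon^2\cdot\left(\frac{2}{3}+\frac{\varepsilon}{2W^3}\right)<\mathbb{E}(\hat D)-D<D\cdot\varepsilon^2\cdot\left(2+\frac{1}{3(1-\varepsilon)^3}\right).$$
   Context: $\hat D$ is the estimator returned by the DistinctMLE query of the SWAMP algorithm. *)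

theory Defs
  imports "HOL-Probability.Probability"
begin

text \<open>A stream is the list of items received so far, the most recent item at the end. Its window
  is the set of IDs among the last \<open>W\<close> items (all items, if there are fewer than \<open>W\<close>).\<close>

definition window :: "nat \<Rightarrow> 'id list \<Rightarrow> 'id set" where
  "window W s = set (drop (length s - W) s)"

text \<open>The universe of IDs is the type \<open>'id\<close>. On the probability space \<open>M\<close>, the random function \<open>h\<close>
  draws the map \<open>h \<omega>\<close>; independence of the family ranges over all IDs and includes that each
  \<open>\<lambda>\<omega>. h \<omega> y\<close> is a random variable with values in \<open>{0..<2^L}\<close>.\<close>

definition random_fingerprints :: "'w measure \<Rightarrow> nat \<Rightarrow> ('w \<Rightarrow> 'id \<Rightarrow> nat) \<Rightarrow> bool" where
  "random_fingerprints M L h \<longleftrightarrow>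
     prob_space M \<and>
     prob_space.indep_vars M (\<lambda>_. count_space {0..<2^L}) (\<lambda>y \<omega>. h \<omega> y) UNIV \<and>
     (\<forall>y. distr M (count_space {0..<2^L}) (\<lambda>\<omega>. h \<omega> y) = uniform_count_measure {0..<2^L})"

definition num_fingerprints :: "('id \<Rightarrow> nat) \<Rightarrow> 'id set \<Rightarrow> nat" where
  "num_fingerprints f A = card (f ` A)"

definition distinct_mle :: "nat \<Rightarrow> nat \<Rightarrow> real" where
  "distinct_mle L Z = ln (1 - real Z / 2^L) / ln (1 - 1 / 2^L)"

end

theory Submission
  imports Defs
begin

text \<open>Let \<open>N = 2^L\<close>, \<open>c = D / N \<le> \<epsilon>\<close> and let \<open>Y\<close> be the proportion of fingerprints that do not occur,
  so that \<open>Dhat = ln Y / ln (1 - 1 / N)\<close>. The mean of \<open>Y\<close> is \<open>m = (1 - 1 / N) ^ D\<close>. By concavity of \<open>ln\<close>,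
  \<open>E (ln Y) \<le> ln m\<close>, so \<open>Dhat\<close> never underestimates on average. Conversely \<open>1 - c \<le> Y \<le> 1\<close>, and bounding
  \<open>1 / Y\<close> by its chord over this interval gives \<open>ln m - E (ln Y) \<le> (m - (1 - c)) (1 - m) / (1 - c)\<close>.
  Since \<open>1 - c \<le> m \<le> 1 / (1 + c)\<close>, this is at most \<open>c ^ 3 / (1 - c)\<close>; thus no variance is needed.\<close>

lemma (in prob_space) expectation_ln_bounds:
  fixes Y :: "'a \<Rightarrow> real"
  assumes meas: "Y \<in> borel_measurable M" and a: "0 < a"
    and Y: "\<And>\<omega>. \<omega> \<in> space M \<Longrightarrow> a \<le> Y \<omega> \<and> Y \<omega> \<le> 1"
  defines "m \<equiv> expectation Y"
  shows "expectation (\<lambda>\<omega>. ln (Y \<omega>)) \<le> ln m"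
    and "ln m - expectation (\<lambda>\<omega>. ln (Y \<omega>)) \<le> (m - a) * (1 - m) / a"
proof -
  have intY: "integrable M Y"
    by (rule integrable_const_bound[where B = 1])
      (use a Y meas in \<open>force intro!: AE_I2\<close>)+
  have intln: "integrable M (\<lambda>\<omega>. ln (Y \<omega>))"
  proof (rule integrable_const_bound[where B = "- ln a"])
    have "\<bar>ln (Y \<omega>)\<bar> \<le> - ln a" if "\<omega> \<in> space M" for \<omega>
      using Y[OF that] a ln_le_zero_iff[of "Y \<omega>"] ln_le_cancel_iff[of a "Y \<omega>"] by linarith
    then show "AE \<omega> in M. norm (ln (Y \<omega>)) \<le> - ln a" by (auto intro!: AE_I2)
  qed (use meas in measurable)
  have am: "a \<le> m"
    unfolding m_def by (rule integral_ge_const[OF intY]) (use Y in \<open>auto intro!: AE_I2\<close>)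
  with a have m: "0 < m" by simp
  \<comment> \<open>The tangent of \<open>ln\<close> at \<open>m\<close> lies above
    \<open>ln\<close>, and its expectation is exactly \<open>ln m\<close>.\<close>
  have "expectation (\<lambda>\<omega>. ln (Y \<omega>)) \<le> expectation (\<lambda>\<omega>. ln m + (Y \<omega> / m - 1))"
  proof (rule integral_mono[OF intln])
    fix \<omega> assume "\<omega> \<in> space M"
    then have "0 < Y \<omega>" using Y a by fastforce
    then show "ln (Y \<omega>) \<le> ln m + (Y \<omega> / m - 1)"
      using ln_le_minus_one[of "Y \<omega> / m"] m by (simp add: ln_div)
  qed (use intY in simp)
  also have "\<dots> = ln m" using intY m by (simp add: m_def[symmetric] prob_space)
  finally show "expectation (\<lambda>\<omega>. ln (Y \<omega>)) \<le> ln m" .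
  have "expectation (\<lambda>\<omega>. ln m - ln (Y \<omega>)) \<le> expectation (\<lambda>\<omega>. m / a * (a + 1 - Y \<omega>) - 1)"
  proof (rule integral_mono)
    fix \<omega> assume "\<omega> \<in> space M"
    then have y: "a \<le> Y \<omega>" "Y \<omega> \<le> 1" "0 < Y \<omega>" using Y a by fastforce+
    \<comment> \<open>Dividing this product by \<open>a * Y \<omega>\<close> gives the chord of
      \<open>1 / Y\<close> over \<open>[a, 1]\<close>. The majorant is then affine in
      \<open>Y\<close>, so its expectation depends on \<open>m\<close> only.\<close>
    have "0 \<le> (Y \<omega> - a) * (1 - Y \<omega>)" using y by simp
    then have "1 / Y \<omega> \<le> (a + 1 - Y \<omega>) / a"
      using y a by (simp add: field_simps)
    then have "m * (1 / Y \<omega>) \<le> m * ((a + 1 - Y \<omega>) / a)"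
      using m by (intro mult_left_mono) auto
    then show "ln m - ln (Y \<omega>) \<le> m / a * (a + 1 - Y \<omega>) - 1"
      using ln_le_minus_one[of "m / Y \<omega>"] m y by (simp add: ln_div)
  qed (use intY intln in simp_all)
  moreover have "expectation (\<lambda>\<omega>. m / a * (a + 1 - Y \<omega>) - 1) = m / a * (a + 1 - m) - 1"
    using intY by (simp add: m_def[symmetric] prob_space)
  moreover have "m / a * (a + 1 - m) - 1 = (m - a) * (1 - m) / a"
    using a by (simp add: field_simps)
  ultimately show "ln m - expectation (\<lambda>\<omega>. ln (Y \<omega>)) \<le> (m - a) * (1 - m) / a"
    using intln by (simp add: prob_space)
qed

text \<open>Bernoulli at \<open>- x\<close> gives the first bound; Bernoulli at \<open>x\<close>
  gives the second, because \<open>(1 - x) ^ n * (1 + x) ^ n \<le> 1\<close>. With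
  \<open>x = 1 / 2 ^ L\<close> and \<open>n = card A\<close> they enclose the mean
  \<open>m\<close>.\<close>

lemma power_one_minus_bounds:
  fixes x :: real
  assumes "0 \<le> x" "x \<le> 1"
  shows "1 - real n * x \<le> (1 - x) ^ n" and "(1 - x) ^ n \<le> 1 / (1 + real n * x)"
proof -
  show "1 - real n * x \<le> (1 - x) ^ n"
    using Bernoulli_inequality[of "- x" n] assms by simp
  have "(1 - x) ^ n * (1 + real n * x) \<le> (1 - x) ^ n * (1 + x) ^ n"
    using Bernoulli_inequality[of x n] assms by (intro mult_left_mono) auto
  also have "\<dots> = (1 - x\<^sup>2) ^ n"
    by (simp add: power_mult_distrib[symmetric] algebra_simps power2_eq_square)
  also have "\<dots> \<le> 1"
    using assms by (intro power_le_one) (auto simp: power_le_one)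
  finally show "(1 - x) ^ n \<le> 1 / (1 + real n * x)"
    using assms by (simp add: pos_le_divide_eq add_pos_nonneg)
qed

context
  fixes M :: "'w measure" and L :: nat and h :: "'w \<Rightarrow> 'id \<Rightarrow> nat" and A :: "'id set"
  assumes fp: "random_fingerprints M L h" and A: "finite A" "A \<noteq> {}"
begin

interpretation prob_space M
  using fp by (simp add: random_fingerprints_def)

lemma fingerprint_less: "\<omega> \<in> space M \<Longrightarrow> h \<omega> y < 2 ^ L"
  using fp by (auto simp: random_fingerprints_def indep_vars_def dest!: spec[where x = y] measurable_space)

lemma prob_fingerprint_neq:
  assumes "v < 2 ^ L"
  shows "prob ((\<lambda>\<omega>. h \<omega> y) -` ({0..<2 ^ L} - {v}) \<inter> space M) = 1 - 1 / 2 ^ L"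
proof -
  have rv: "(\<lambda>\<omega>. h \<omega> y) \<in> measurable M (count_space {0..<2 ^ L})"
    using fp by (auto simp: random_fingerprints_def indep_vars_def)
  have "prob ((\<lambda>\<omega>. h \<omega> y) -` ({0..<2 ^ L} - {v}) \<inter> space M)
    = measure (distr M (count_space {0..<2 ^ L}) (\<lambda>\<omega>. h \<omega> y)) ({0..<2 ^ L} - {v})"
    by (subst measure_distr[OF rv]) auto
  also have "\<dots> = measure (uniform_count_measure {0..<2 ^ L}) ({0..<2 ^ L} - {v})"
    using fp by (simp add: random_fingerprints_def)
  also have "\<dots> = (2 ^ L - 1) / 2 ^ L"
    using assms by (subst measure_uniform_count_measure) (auto simp: card_Diff_singleton of_nat_diff)
  finally show ?thesis by (simp add: diff_divide_distrib)
qed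

text \<open>Missing a value is an intersection of independent events, one per ID, so its probability
  factorizes; hitting a value would be a union.\<close>

definition missed :: "nat \<Rightarrow> 'w set" where
  "missed v = {\<omega> \<in> space M. v \<notin> h \<omega> ` A}"

text \<open>The form to which independence and measurability apply. Nonemptiness of \<open>A\<close>
  matters: an empty intersection would be \<open>UNIV\<close> instead of
  \<open>space M\<close>.\<close>

lemma missed_eq_INT:
  "missed v = (\<Inter>y\<in>A. (\<lambda>\<omega>. h \<omega> y) -` ({0..<2 ^ L} - {v}) \<inter> space M)"
  using A fingerprint_less by (auto simp: missed_def)

lemma missed_sets: "missed v \<in> sets M"
proof -
  have "(\<lambda>\<omega>. h \<omega> y) \<in> measurable M (count_space {0..<2 ^ L})" for y
    using fp by (auto simp: random_fingerprints_def indep_vars_def)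
  then show ?thesis
    unfolding missed_eq_INT using A by (intro sets.finite_INT) (auto intro!: measurable_sets)
qed

lemma prob_missed:
  assumes "v < 2 ^ L"
  shows "prob (missed v) = (1 - 1 / 2 ^ L) ^ card A"
proof -
  have "indep_vars (\<lambda>_. count_space {0..<2 ^ L}) (\<lambda>y \<omega>. h \<omega> y) UNIV"
    using fp by (simp add: random_fingerprints_def)
  then have "prob (missed v)
      = (\<Prod>y\<in>A. prob ((\<lambda>\<omega>. h \<omega> y) -` ({0..<2 ^ L} - {v}) \<inter> space M))"
    unfolding missed_eq_INT using A by (intro indep_varsD) auto
  then show ?thesis by (simp add: prob_fingerprint_neq[OF assms])
qed

text \<open>The variable \<open>Y\<close> of the overview, written with indicators so that linearity
  yields its mean without the law of the number of fingerprints.\<close>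

definition missed_ratio :: "'w \<Rightarrow> real" where
  "missed_ratio \<omega> = (\<Sum>v<2 ^ L. indicator (missed v) \<omega>) / 2 ^ L"

lemma missed_ratio_measurable: "missed_ratio \<in> borel_measurable M"
  unfolding missed_ratio_def[abs_def] using missed_sets by measurable

lemma missed_ratio_eq:
  assumes "\<omega> \<in> space M"
  shows "missed_ratio \<omega> = 1 - real (num_fingerprints (h \<omega>) A) / 2 ^ L"
proof -
  have sub: "h \<omega> ` A \<subseteq> {..<2 ^ L}" using fingerprint_less[OF assms] by auto
  have "(\<Sum>v<2 ^ L. indicator (missed v) \<omega> :: real) = (\<Sum>v<2 ^ L. indicator (- (h \<omega> ` A)) v)"
    using assms by (intro sum.cong) (auto simp: missed_def indicator_def)
  also have "\<dots> = real (card ({..<2 ^ L} - h \<omega> ` A))"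
    by (simp add: indicator_def sum.If_cases Diff_eq Compl_eq)
  also have "\<dots> = 2 ^ L - real (num_fingerprints (h \<omega>) A)"
    using sub card_mono[OF _ sub]
    by (simp add: card_Diff_subset[OF finite_subset[OF sub]] num_fingerprints_def of_nat_diff)
  finally show ?thesis by (simp add: missed_ratio_def diff_divide_distrib)
qed

text \<open>At most \<open>card A\<close> values are hit. For \<open>card A < 2 ^ L\<close> this
  keeps the argument of \<open>ln\<close> above a positive constant, as
  \<open>expectation_ln_bounds\<close> requires.\<close>

lemma missed_ratio_bounds:
  assumes "\<omega> \<in> space M"
  shows "1 - real (card A) / 2 ^ L \<le> missed_ratio \<omega>" and "missed_ratio \<omega> \<le> 1"
  using card_image_le[OF A(1), of "h \<omega>"]
  by (simp_all add: missed_ratio_eq[OF assms] num_fingerprints_def divide_right_mono)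

lemma expectation_missed_ratio: "expectation missed_ratio = (1 - 1 / 2 ^ L) ^ card A"
proof -
  have "expectation missed_ratio = (\<Sum>v<2 ^ L. prob (missed v)) / 2 ^ L"
    unfolding missed_ratio_def[abs_def]
    using missed_sets
    by (simp add: Bochner_Integration.integral_sum integrable_real_indicator emeasure_eq_measure
        sets.Int_space_eq2)
  also have "\<dots> = (1 - 1 / 2 ^ L) ^ card A"
    by (simp add: prob_missed)
  finally show ?thesis .
qed

lemma expectation_distinct_mle_bounds:
  assumes card: "card A < 2 ^ L"
  defines "c \<equiv> real (card A) / 2 ^ L"
  defines "E \<equiv> expectation (\<lambda>\<omega>. distinct_mle L (num_fingerprints (h \<omega>) A))"
  shows "real (card A) \<le> E" and "E \<le> real (card A) + real (card A) * c\<^sup>2 / (1 - c)"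
proof -
  define b where "b = (1 - 1 / 2 ^ L :: real)"
  define m where "m = b ^ card A"
  have D: "1 \<le> card A" using A by (simp add: Suc_leI card_gt_0_iff)
  \<comment> \<open>This excludes \<open>L = 0\<close>, where \<open>b\<close> would be
    \<open>0\<close> and \<open>ln b\<close> meaningless.\<close>
  with card have "1 < (2::nat) ^ L" by simp
  then have L: "(1::real) < 2 ^ L" using of_nat_less_iff[of 1 "2 ^ L", where 'a = real] by simp
  have b: "0 < b" "b < 1" using L by (auto simp: b_def)
  have c: "0 < c" "c < 1"
    using D card of_nat_less_iff[of "card A" "2 ^ L", where 'a = real] by (auto simp: c_def)
  have lnb: "ln b \<le> - (1 / 2 ^ L)" using ln_le_minus_one[of b] b by (simp add: b_def)
  have lnb0: "ln b < 0" using b by simp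
  have mE: "m = expectation missed_ratio" by (simp add: m_def b_def expectation_missed_ratio)
  have "E = expectation (\<lambda>\<omega>. ln (missed_ratio \<omega>) / ln b)"
    unfolding E_def
    by (intro Bochner_Integration.integral_cong) (simp_all add: distinct_mle_def b_def missed_ratio_eq)
  then have E: "E = expectation (\<lambda>\<omega>. ln (missed_ratio \<omega>)) / ln b" by simp
  have lnm: "ln m = real (card A) * ln b" using b by (simp add: m_def ln_realpow)
  have bnd: "1 - c \<le> missed_ratio \<omega> \<and> missed_ratio \<omega> \<le> 1" if "\<omega> \<in> space M" for \<omega>
    using missed_ratio_bounds[OF that] by (simp add: c_def)
  have 1: "expectation (\<lambda>\<omega>. ln (missed_ratio \<omega>)) \<le> ln m"
    and 2: "ln m - expectation (\<lambda>\<omega>. ln (missed_ratio \<omega>)) \<le> (m - (1 - c)) * (1 - m) / (1 - c)"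
    using expectation_ln_bounds[OF missed_ratio_measurable _ bnd] c by (auto simp: mE)
  \<comment> \<open>Division by the negative \<open>ln b\<close> reverses the Jensen bound, and
    \<open>ln m / ln b\<close> is exactly \<open>card A\<close>.\<close>
  show "real (card A) \<le> E"
    using 1 lnb0 by (simp add: E lnm neg_le_divide_eq)
  have m1: "1 - c \<le> m" and m2: "m \<le> 1 / (1 + c)"
    using power_one_minus_bounds[of "1 / 2 ^ L" "card A"] L by (auto simp: m_def b_def c_def)
  have m3: "m \<le> 1" using b by (simp add: m_def power_le_one)
  \<comment> \<open>The first factor is of second order in \<open>c\<close> and \<open>1 - m\<close>
    is at most \<open>c\<close>, whence the cubic bound.\<close>
  have "1 / (1 + c) - (1 - c) = c\<^sup>2 / (1 + c)"
    using c by (simp add: field_simps power2_eq_square)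
  also have "\<dots> \<le> c\<^sup>2" using c by (simp add: divide_le_eq mult_le_cancel_left1)
  finally have "m - (1 - c) \<le> c\<^sup>2" using m2 by simp
  then have "(m - (1 - c)) * (1 - m) \<le> c\<^sup>2 * c"
    using m1 m3 c by (intro mult_mono) auto
  then have "(m - (1 - c)) * (1 - m) / (1 - c) \<le> c\<^sup>2 * c / (1 - c)"
    using c by (intro divide_right_mono) auto
  with 2 have 3: "ln m - expectation (\<lambda>\<omega>. ln (missed_ratio \<omega>)) \<le> c\<^sup>2 * c / (1 - c)" by simp
  \<comment> \<open>Replacing \<open>- ln b\<close> by the smaller \<open>1 / 2 ^ L\<close> is sound
    because the bias is already known to be nonnegative. The factor \<open>2 ^ L\<close> then
    absorbs one power of \<open>c\<close>, as \<open>2 ^ L * c = card A\<close>.\<close>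
  have "(E - real (card A)) * (1 / 2 ^ L) \<le> (E - real (card A)) * (- ln b)"
    using lnb \<open>real (card A) \<le> E\<close> by (intro mult_left_mono) auto
  also have "\<dots> = ln m - expectation (\<lambda>\<omega>. ln (missed_ratio \<omega>))"
    using lnb0 by (simp add: E lnm field_simps)
  also have "\<dots> \<le> c\<^sup>2 * c / (1 - c)" by (fact 3)
  finally have "E - real (card A) \<le> 2 ^ L * (c\<^sup>2 * c / (1 - c))"
    by (simp add: divide_le_eq mult.commute)
  also have "\<dots> = real (card A) * c\<^sup>2 / (1 - c)" by (simp add: c_def)
  finally show "E \<le> real (card A) + real (card A) * c\<^sup>2 / (1 - c)" by simp
qed

end

theorem theorem15:
  fixes W L :: nat and \<epsilon> :: real and s :: "'id list"
    and M :: "'w measure" and h :: "'w \<Rightarrow> 'id \<Rightarrow> nat"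
  defines "D \<equiv> real (card (window W s))"
    and "Dhat \<equiv> \<lambda>\<omega>. distinct_mle L (num_fingerprints (h \<omega>) (window W s))"
  assumes "W \<ge> 1" and "0 < \<epsilon>" and "\<epsilon> < 1"
    and "real W * inverse \<epsilon> = 2 ^ L"
    and "W \<le> length s"
    and "random_fingerprints M L h"
  shows "- D * \<epsilon>\<^sup>2 * (2 / 3 + \<epsilon> / (2 * real W ^ 3)) < prob_space.expectation M Dhat - D
       \<and> prob_space.expectation M Dhat - D < D * \<epsilon>\<^sup>2 * (2 + 1 / (3 * (1 - \<epsilon>) ^ 3))"
proof -
  let ?A = "window W s"
  define c where "c = D / 2 ^ L"
  define u where "u = 1 / (1 - \<epsilon>)"
  have fin: "finite ?A" by (simp add: window_def)
  \<comment> \<open>A nonempty window makes \<open>D\<close> positive; for \<open>D = 0\<close> both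
    strict inequalities would read \<open>0 < 0\<close>.\<close>
  have ne: "?A \<noteq> {}" using assms(3,7) by (auto simp: window_def)
  have cardW: "card ?A \<le> W"
    using card_length[of "drop (length s - W) s"] assms(7) by (simp add: window_def)
  have W: "real W = \<epsilon> * 2 ^ L" using assms(4,6) by (simp add: field_simps)
  have "real (card ?A) \<le> \<epsilon> * 2 ^ L" using cardW W by linarith
  also have "\<dots> < 1 * 2 ^ L" using assms(5) by (intro mult_strict_right_mono) auto
  finally have card: "card ?A < 2 ^ L" using of_nat_less_iff[of "card ?A" "2 ^ L", where 'a = real] by simp
  have D: "0 < D" using fin ne by (simp add: D_def card_gt_0_iff)
  have c: "0 < c" "c \<le> \<epsilon>"
    using D cardW W by (auto simp: c_def divide_le_eq D_def)
  have lo: "D \<le> prob_space.expectation M Dhat"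
    and hi: "prob_space.expectation M Dhat \<le> D + D * c\<^sup>2 / (1 - c)"
    using expectation_distinct_mle_bounds[OF assms(8) fin ne card]
    unfolding D_def Dhat_def c_def by auto
  have u: "1 \<le> u" using assms(4,5) by (simp add: u_def)
  \<comment> \<open>The product expands to \<open>u ^ 3 - 3 * u + 2\<close>, so
    \<open>u \<le> (u ^ 3 + 2) / 3\<close>, which is below the stated constant.\<close>
  have "0 \<le> (u - 1)\<^sup>2 * (u + 2)" using u by simp
  then have u3: "u < 2 + u ^ 3 / 3" by (simp add: power2_eq_square power3_eq_cube algebra_simps)
  \<comment> \<open>The bound grows with \<open>c\<close>, so \<open>c\<close> may be replaced by
    \<open>\<epsilon>\<close>.\<close>
  have "D * c\<^sup>2 / (1 - c) \<le> D * \<epsilon>\<^sup>2 / (1 - \<epsilon>)"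
    using c D assms(4,5) by (intro frac_le mult_left_mono power_mono) auto
  also have "\<dots> = D * \<epsilon>\<^sup>2 * u" by (simp add: u_def)
  also have "\<dots> < D * \<epsilon>\<^sup>2 * (2 + u ^ 3 / 3)"
    using u3 D assms(4) by (intro mult_strict_left_mono) auto
  also have "u ^ 3 / 3 = 1 / (3 * (1 - \<epsilon>) ^ 3)" by (simp add: u_def power_one_over)
  finally have "prob_space.expectation M Dhat - D < D * \<epsilon>\<^sup>2 * (2 + 1 / (3 * (1 - \<epsilon>) ^ 3))"
    using hi by simp
  \<comment> \<open>The bias is nonnegative, so the lower estimate only needs its left side to be
    strictly negative.\<close>
  moreover have "0 < D * \<epsilon>\<^sup>2 * (2 / 3 + \<epsilon> / (2 * real W ^ 3))"
    using D assms(3,4) by (intro mult_pos_pos add_pos_nonneg) auto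
  ultimately show ?thesis using lo by simp
qed

end
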